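(* Consider exact data, i.e. $\delta_i=0$ and $y_i^\delta=y_i$ for $i=0,\dots,N-1$, so that the iteration reads $x_{k+1}=x_k+h_k$ with $$h_k=\big(F_{[k]}'(x_k)^*F_{[k]}'(x_k)+\alpha I\big)^{-1}F_{[k]}'(x_k)^*\big(y_{[k]}-F_{[k]}(x_k)\big),\qquad k=0,1,2,\dots,$$ started at $x_0$. Then $x_k$ converges in $X$, as $k\to\infty$, to a solution of the system $F_i(x)=y_i$, $i=0,\dots,N-1$. Moreover, if the kernel condition $$\mathcal N(\mathbf F'(x^\dagger))\subseteq\mathcal N(\mathbf F'(x))\quad\text{for all }x\in B_\rho(x_0)$$ is satisfied, where $\mathcal N$ denotes the null space, then $x_k\to x^\dagger$ as $k\to\infty$.
   Context: Setting. $X,Y$ are Hilbert spaces, $N\ge 1$, $F_i:D_i\subset X\to Y$ for $i=0,\dots,N-1$, and $y_0,\dots,y_{N-1}\in Y$ are exact data. For each $i$ and $x \in D_i$, $F_i'(x):X\to Y$ denotes a bounded linear operator (the "linearization" of $F_i$ at $x$; it need not be the Fréchet derivative). $\mathbf F:=(F_0,\dots,F_{N-1}):\bigcap_i D_i\to Y^N$, $\mathbf F'(x):=(F_0'(x),\dots,F_{N-1}'(x)):X\to Y^N$, $y:=(y_0,\dots,y_{N-1})$. $B_r(z)$ is the open ball of radius $r$ around $z$ in $X$. $[k]:=k \bmod N\in\{0,\dots,N-1\}$. Standing assumptions. (1) $x_0\in X$ and $\rho>0$ satisfy $B_\rho(x_0)\subset\bigcap_{i}D_i$; the maps $F_i$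 and $x\mapsto F_i'(x)$ (operator norm) are continuous; there is $C>0$ with $\|F_i'(x)\|\le C$ for all $x\in B_\rho(x_0)$ and all $i$. (2) (Local tangential cone condition) For some $\eta<1$ and all $i$: $\|F_i(\bar x)-F_i(x)-F_i'(x)(\bar x-x)\|\le\eta\|F_i(\bar x)-F_i(x)\|$ for all $x,\bar x\in B_\rho(x_0)$. (3) There is $x^*\in B_{\rho/2}(x_0)$ with $\mathbf F(x^* )=y$. (4) The constants $\alpha,\tau,q$ satisfy $0<q<1$, $\alpha>\frac{C^2q}{1-q}$, $\tau>\frac{1+\eta}{1-\eta}>1$, and $\eta+(1+\eta)\tau^{-1}<q<1$. $x^\dagger$ denotes the $x_0$-minimal norm solution in $B_{\rho/2}(x_0)$, i.e. the element $x^\dagger\in B_{\rho/2}(x_0)$ with $\mathbf F(x^\dagger)=y$ and $\|x^\dagger-x_0\|=\inf\{\|x-x_0\|: x\in B_{\rho/2}(x_0),\ \mathbf F(x)=y\}$ (which exists under the assumptions above). *)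

theory Defs
  imports "HOL-Analysis.Analysis"
begin

(* Elements of the product space Y^N are functions nat => Y restricted to {..<N}
   (i.e. "undefined" outside), so that equality of tuples only concerns the indices i < N. *)

definition prod_map :: "nat \<Rightarrow> (nat \<Rightarrow> 'a \<Rightarrow> 'b) \<Rightarrow> 'a \<Rightarrow> nat \<Rightarrow> 'b" where
  "prod_map N F x = (\<lambda>i\<in>{..<N}. F i x)"

definition prod_null_space ::
  "nat \<Rightarrow> (nat \<Rightarrow> 'a::real_normed_vector \<Rightarrow> ('a \<Rightarrow>\<^sub>L 'b::real_normed_vector)) \<Rightarrow> 'a \<Rightarrow> 'a set" where
  "prod_null_space N F' x = {h. prod_map N (\<lambda>i. blinfun_apply (F' i x)) h = (\<lambda>i\<in>{..<N}. 0)}"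

definition min_norm_solution ::
  "nat \<Rightarrow> (nat \<Rightarrow> 'a::real_normed_vector \<Rightarrow> 'b) \<Rightarrow> (nat \<Rightarrow> 'b) \<Rightarrow> 'a \<Rightarrow> real \<Rightarrow> 'a \<Rightarrow> bool" where
  "min_norm_solution N F y x0 \<rho> z \<longleftrightarrow>
     z \<in> ball x0 (\<rho> / 2) \<and> prod_map N F z = restrict y {..<N} \<and>
     norm (z - x0) =
       Inf {norm (x - x0) | x. x \<in> ball x0 (\<rho> / 2) \<and> prod_map N F x = restrict y {..<N}}"

(* (A* A + alpha I)^{-1} A* r.  The library's adjoint is a choice-based operator; for bounded
   linear maps between Hilbert spaces it is the Hilbert space adjoint, and for alpha > 0 the
   map being inverted is a bijection. *)
definition lm_step ::
  "('a::{real_inner, complete_space} \<Rightarrow>\<^sub>L 'b::{real_inner, complete_space}) \<Rightarrow> real \<Rightarrow> 'b \<Rightarrow> 'a" where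
  "lm_step A \<alpha> r =
     inv (\<lambda>h. adjoint (blinfun_apply A) (blinfun_apply A h) + \<alpha> *\<^sub>R h)
       (adjoint (blinfun_apply A) r)"

primrec lmk_iter ::
  "nat \<Rightarrow> (nat \<Rightarrow> 'a \<Rightarrow> 'b) \<Rightarrow>
   (nat \<Rightarrow> 'a \<Rightarrow> ('a::{real_inner, complete_space} \<Rightarrow>\<^sub>L 'b::{real_inner, complete_space})) \<Rightarrow>
   (nat \<Rightarrow> 'b) \<Rightarrow> real \<Rightarrow> 'a \<Rightarrow> nat \<Rightarrow> 'a" where
  "lmk_iter N F F' y \<alpha> x0 0 = x0"
| "lmk_iter N F F' y \<alpha> x0 (Suc k) =
     (let x = lmk_iter N F F' y \<alpha> x0 k; i = k mod N
      in x + lm_step (F' i x) \<alpha> (y i - F i x))"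

end

theory Submission
  imports Defs
begin

text \<open>Writing \<open>h = A\<^sup>* w\<close> with \<open>\<alpha> w = r - A h\<close>, the bound \<open>\<parallel>\<alpha> w\<parallel> \<ge> q \<parallel>r\<parallel>\<close> and the tangential cone
  condition make the squared error to any solution drop by a multiple of \<open>\<parallel>r\<parallel>\<^sup>2\<close> in each step.
  Hence the iterates stay in the ball and the residuals are square summable.  The iterates at the
  beginning of each cycle of \<open>N\<close> steps form a Cauchy sequence: the increments \<open>h\<close> lie in the range
  of \<open>A\<^sup>*\<close>, so their inner products with the error of a pivot iterate are bounded by products of
  residuals, and the pivot is the cycle with the smallest residual.  Under the kernel condition
  all iterates stay in \<open>x\<^sub>0 + N(F'(x\<^sup>\<dagger>))\<^sup>\<bottom>\<close>, whereas by the tangential cone condition the limit differs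
  from \<open>x\<^sup>\<dagger>\<close> by an element of the kernel; Pythagoras and minimality then identify the two.\<close>

section \<open>Variational form of the regularized step\<close>

text \<open>First-order condition at a minimum: if \<open>a\<close> were nonzero, the vertex
  \<open>t = - a / b\<close> (for \<open>b > 0\<close>) or \<open>t = - a\<close> (otherwise) would
  give a negative value.\<close>

lemma linear_coefficient_zero:
  fixes a b :: real
  assumes "\<And>t. 0 \<le> 2 * t * a + t\<^sup>2 * b"
  shows "a = 0"
proof (rule ccontr)
  assume a: "a \<noteq> 0"
  show False
  proof (cases "b > 0")
    case True
    have "2 * (- a / b) * a + (- a / b)\<^sup>2 * b = - a\<^sup>2 / b"
      using True by (simp add: field_simps power2_eq_square)
    moreover have "a\<^sup>2 / b > 0" using a True by simp
    ultimately show False using assms[of "- a / b"] by simp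
  next
    case False
    have "2 * (- a) * a + (- a)\<^sup>2 * b = a\<^sup>2 * (b - 2)"
      by (simp add: algebra_simps power2_eq_square)
    also have "\<dots> < 0" using a False by (intro mult_pos_neg) auto
    finally show False using assms[of "- a"] by simp
  qed
qed

text \<open>The minimizer of \<open>\<parallel>A h\<parallel>\<^sup>2 + \<alpha> \<parallel>h\<parallel>\<^sup>2 - 2 \<phi> h\<close>. For \<open>A = 0\<close> this is the Riesz representation, which
  yields the adjoint; for \<open>\<phi> v = r \<bullet> A v\<close> it inverts \<open>A\<^sup>* A + \<alpha> I\<close> at \<open>A\<^sup>* r\<close>.\<close>

lemma regularized_riesz:
  fixes A :: "'a::{real_inner, complete_space} \<Rightarrow> 'b::real_inner"
    and \<phi> :: "'a \<Rightarrow> real"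
  assumes A: "bounded_linear A" and phi: "bounded_linear \<phi>" and \<alpha>: "\<alpha> > 0"
  obtains h where "\<And>v. A h \<bullet> A v + \<alpha> * (h \<bullet> v) = \<phi> v"
proof -
  interpret A: bounded_linear A by fact
  interpret phi: bounded_linear \<phi> by fact
  define J where "J u = (norm (A u))\<^sup>2 + \<alpha> * (norm u)\<^sup>2 - 2 * \<phi> u" for u
  obtain K where K: "\<And>x. \<bar>\<phi> x\<bar> \<le> norm x * K"
    using phi.bounded by auto
  \<comment> \<open>Completing the square in \<open>\<alpha> * norm u - K\<close> leaves the defect
    \<open>K\<^sup>2 / \<alpha>\<close>.\<close>
  have lower: "- (K\<^sup>2 / \<alpha>) \<le> J u" for u
  proof -
    have "0 \<le> (\<alpha> * norm u - K)\<^sup>2 / \<alpha>" using \<alpha> by simp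
    also have "\<dots> = \<alpha> * (norm u)\<^sup>2 - 2 * (norm u * K) + K\<^sup>2 / \<alpha>"
      using \<alpha> by (simp add: field_simps power2_eq_square)
    finally have "0 \<le> \<alpha> * (norm u)\<^sup>2 - 2 * (norm u * K) + K\<^sup>2 / \<alpha>" .
    moreover have "\<phi> u \<le> norm u * K" using K[of u] by simp
    moreover have "(norm (A u))\<^sup>2 \<ge> 0" by simp
    ultimately show ?thesis unfolding J_def by linarith
  qed
  define m where "m = Inf (range J)"
  have bdd: "bdd_below (range J)" using lower by (intro bdd_belowI) auto
  have m_le: "m \<le> J u" for u unfolding m_def using bdd by (intro cInf_lower) auto
  have "\<exists>u. J u < m + inverse (real (Suc n))" for n
  proof (rule ccontr)
    assume "\<not> ?thesis"
    then have "m + inverse (real (Suc n)) \<le> m"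
      unfolding m_def by (intro cInf_greatest) (auto simp: not_less)
    then show False by simp
  qed
  then obtain u where u: "\<And>n. J (u n) < m + inverse (real (Suc n))" by metis
  \<comment> \<open>Parallelogram law with midpoint \<open>c\<close>: the linear terms cancel and
    \<open>J c\<close> is at least \<open>m\<close>. Hence minimizing sequences are Cauchy.\<close>
  have parallelogram: "\<alpha> * (norm (a - b))\<^sup>2 \<le> 2 * (J a - m) + 2 * (J b - m)" for a b
  proof -
    define c where "c = (1/2) *\<^sub>R (a + b)"
    have "\<alpha> * (norm (a - b))\<^sup>2 + (norm (A (a - b)))\<^sup>2 = 2 * J a + 2 * J b - 4 * J c"
      unfolding J_def power2_norm_eq_inner c_def
      by (simp add: A.add A.diff A.scaleR phi.add phi.diff phi.scaleR inner_add_left inner_add_right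
          inner_diff_left inner_diff_right inner_commute algebra_simps)
    moreover have "(norm (A (a - b)))\<^sup>2 \<ge> 0" by simp
    ultimately show ?thesis using m_le[of c] by argo
  qed
  have "Cauchy u"
  proof (rule metric_CauchyI)
    fix e :: real assume e: "e > 0"
    then have "\<alpha> * e\<^sup>2 / 4 > 0" using \<alpha> by simp
    then obtain M where M: "inverse (real (Suc M)) < \<alpha> * e\<^sup>2 / 4"
      using reals_Archimedean by blast
    have small: "J (u n) - m < \<alpha> * e\<^sup>2 / 4" if "n \<ge> M" for n
    proof -
      have "inverse (real (Suc n)) \<le> inverse (real (Suc M))" using that by (intro le_imp_inverse_le) auto
      then show ?thesis using u[of n] M by linarith
    qed
    show "\<exists>M. \<forall>p\<ge>M. \<forall>n\<ge>M. dist (u p) (u n) < e"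
    proof (intro exI allI impI)
      fix p n assume "p \<ge> M" "n \<ge> M"
      then have "\<alpha> * (norm (u p - u n))\<^sup>2 < \<alpha> * e\<^sup>2"
        using parallelogram[of "u p" "u n"] small[OF \<open>p \<ge> M\<close>] small[OF \<open>n \<ge> M\<close>] by argo
      then have "(norm (u p - u n))\<^sup>2 < e\<^sup>2" using \<alpha> by simp
      then show "dist (u p) (u n) < e"
        using e by (simp add: dist_norm power_less_imp_less_base)
    qed
  qed
  then obtain h where h: "u \<longlonglongrightarrow> h" using Cauchy_convergent convergent_def by blast
  have "(\<lambda>n. J (u n)) \<longlonglongrightarrow> J h"
    unfolding J_def by (intro tendsto_intros A.tendsto phi.tendsto h)
  moreover have "(\<lambda>n. m + inverse (real (Suc n))) \<longlonglongrightarrow> m + 0"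
    by (intro tendsto_intros LIMSEQ_inverse_real_of_nat)
  ultimately have "J h \<le> m + 0"
    using u by (intro LIMSEQ_le) (auto intro!: exI[of _ 0] less_imp_le)
  then have min: "J h \<le> J v" for v using m_le[of v] by simp
  have "A h \<bullet> A v + \<alpha> * (h \<bullet> v) - \<phi> v = 0" for v
  proof (rule linear_coefficient_zero)
    fix t
    have "J (h + t *\<^sub>R v) - J h
        = 2 * t * (A h \<bullet> A v + \<alpha> * (h \<bullet> v) - \<phi> v) + t\<^sup>2 * ((norm (A v))\<^sup>2 + \<alpha> * (norm v)\<^sup>2)"
      unfolding J_def power2_norm_eq_inner
      by (simp add: A.add A.scaleR phi.add phi.scaleR inner_add_left inner_add_right
          inner_commute algebra_simps power2_eq_square)
    then show "0 \<le> 2 * t * (A h \<bullet> A v + \<alpha> * (h \<bullet> v) - \<phi> v) + t\<^sup>2 * ((norm (A v))\<^sup>2 + \<alpha> * (norm v)\<^sup>2)"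
      using min[of "h + t *\<^sub>R v"] by linarith
  qed
  then have "A h \<bullet> A v + \<alpha> * (h \<bullet> v) = \<phi> v" for v
    by (rule eq_iff_diff_eq_0[THEN iffD2])
  then show ?thesis by (rule that)
qed

text \<open>As \<open>adjoint\<close> is defined by choice, its characteristic property follows once
  some map has it; the Riesz vectors of \<open>\<lambda>v. A v \<bullet> y\<close> form such a
  map.\<close>

lemma hilbert_adjoint_works:
  fixes A :: "'a::{real_inner, complete_space} \<Rightarrow> 'b::real_inner"
  assumes "bounded_linear A"
  shows "x \<bullet> adjoint A y = A x \<bullet> y"
proof -
  have "\<exists>g. \<forall>v. g \<bullet> v = A v \<bullet> y" for y
  proof -
    have "bounded_linear (\<lambda>v. A v \<bullet> y)"
      by (rule bounded_linear_inner_left_comp[OF assms])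
    then obtain g where "\<And>v. 0 \<bullet> (0 :: 'b) + 1 * (g \<bullet> v) = A v \<bullet> y"
      by (rule regularized_riesz[OF bounded_linear_zero _ zero_less_one]) blast
    then show ?thesis by auto
  qed
  then obtain g where "\<forall>x y. A x \<bullet> y = x \<bullet> g y" by (metis inner_commute)
  then have "\<forall>x y. A x \<bullet> y = x \<bullet> adjoint A y"
    unfolding adjoint_def by (rule someI[where x = g])
  then show ?thesis by simp
qed

text \<open>Weak form of the normal equation, which spares all later arguments
  \<open>adjoint\<close> and \<open>inv\<close>. The variational solution is a preimage of
  \<open>adjoint A r\<close> under \<open>G\<close>, and injectivity of \<open>G\<close> makes
  \<open>inv\<close> return it.\<close>

lemma lm_step_inner:
  fixes A :: "'a::{real_inner, complete_space} \<Rightarrow>\<^sub>L 'b::{real_inner, complete_space}"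
  assumes \<alpha>: "\<alpha> > 0"
  shows "\<alpha> * (lm_step A \<alpha> r \<bullet> v) = (r - A (lm_step A \<alpha> r)) \<bullet> A v"
proof -
  note adj = hilbert_adjoint_works[OF blinfun.bounded_linear_right[of A]]
  define G where "G h = adjoint A (A h) + \<alpha> *\<^sub>R h" for h
  have G: "G h \<bullet> v = A h \<bullet> A v + \<alpha> * (h \<bullet> v)" for h v
    using adj[of v "A h"] by (simp add: G_def inner_add_left inner_add_right inner_commute)
  have "inj G"
  proof (rule injI)
    fix a b assume "G a = G b"
    then have "(G a - G b) \<bullet> (a - b) = 0" by simp
    then have "(norm (A (a - b)))\<^sup>2 + \<alpha> * (norm (a - b))\<^sup>2 = 0"
      unfolding power2_norm_eq_inner
      by (simp add: inner_diff_left G blinfun.diff_right inner_diff_right algebra_simps)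
    moreover have "(norm (A (a - b)))\<^sup>2 \<ge> 0" by simp
    moreover have "\<alpha> * (norm (a - b))\<^sup>2 \<ge> 0" using \<alpha> by simp
    ultimately have "\<alpha> * (norm (a - b))\<^sup>2 = 0" by linarith
    then show "a = b" using \<alpha> by simp
  qed
  obtain h where h: "\<And>v. A h \<bullet> A v + \<alpha> * (h \<bullet> v) = r \<bullet> A v"
    using regularized_riesz[OF blinfun.bounded_linear_right[of A]
        bounded_linear_inner_right_comp[OF blinfun.bounded_linear_right[of A]] \<alpha>] by metis
  have "G h \<bullet> v = adjoint A r \<bullet> v" for v
    using h[of v] adj[of v r] G[of h v] by (metis inner_commute)
  then have "G h = adjoint A r" using vector_eq_rdot by blast
  then have "lm_step A \<alpha> r = h"
    using inv_f_f[OF \<open>inj G\<close>, of h] by (simp add: lm_step_def G_def[abs_def])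
  then show ?thesis using h[of v] by (simp add: inner_diff_left)
qed

section \<open>A Cauchy criterion from decreasing energy\<close>

text \<open>Pivoting at the index where \<^term>\<open>R\<close> is smallest turns the mixed products
  \<^term>\<open>R b * R n\<close> into squares, which telescope.\<close>

lemma Cauchy_of_energy_decrease:
  fixes X :: "nat \<Rightarrow> 'a::real_inner"
  assumes c: "c > 0" and M: "M \<ge> 0" and R: "\<And>b. R b \<ge> 0"
    and dec: "\<And>b. c * (R b)\<^sup>2 \<le> (norm (X b - z))\<^sup>2 - (norm (X (Suc b) - z))\<^sup>2"
    and incr: "\<And>b n. \<bar>(X (Suc b) - X b) \<bullet> (X n - z)\<bar> \<le> M * R b * (R b + R n)"
  shows "Cauchy X"
proof -
  define E where "E b = (norm (X b - z))\<^sup>2" for b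
  \<comment> \<open>Chosen so that, with \<open>R n \<le> R b\<close> at the pivot, the bound
    \<open>M * R b * (2 * R b)\<close> equals \<open>K * (c * (R b)\<^sup>2)\<close>, at most
    \<open>K\<close> times an energy drop.\<close>
  define K where "K = 2 * M / c"
  have K: "K \<ge> 0" using c M by (simp add: K_def)
  have decE: "c * (R b)\<^sup>2 \<le> E b - E (Suc b)" for b using dec by (simp add: E_def)
  have "E (Suc b) \<le> E b" for b
    using decE[of b] mult_nonneg_nonneg[OF less_imp_le[OF c] zero_le_power2[of "R b"]] by linarith
  then have anti: "decseq E" by (simp add: decseq_Suc_iff)
  have polar: "(norm (X a - X n))\<^sup>2 = E a - E n + 2 * ((X n - X a) \<bullet> (X n - z))" for a n
    unfolding E_def power2_norm_eq_inner
    by (simp add: inner_diff_left inner_diff_right inner_commute)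
  \<comment> \<open>Distances are controlled by energy drops, so convergence of \<open>E\<close>
    makes \<open>X\<close> Cauchy.\<close>
  have close: "(norm (X k - X l))\<^sup>2 \<le> 2 * (1 + 2 * K) * (E k - E l)" if "k \<le> l" for k l
  proof -
    have "{k..l} \<noteq> {}" using that by simp
    then have "\<exists>n. n \<in> {k..l} \<and> (\<forall>b. b \<in> {k..l} \<longrightarrow> R n \<le> R b)"
      using ex_is_arg_min_if_finite[of "{k..l}" R] unfolding is_arg_min_linorder by simp
    then obtain n where n: "n \<in> {k..l}" "\<And>b. b \<in> {k..l} \<Longrightarrow> R n \<le> R b"
      by blast
    have step_bound: "\<bar>(X (Suc b) - X b) \<bullet> (X n - z)\<bar> \<le> K * (E b - E (Suc b))" if "b \<in> {k..l}" for b
    proof -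
      have "M * R b * (R b + R n) \<le> M * R b * (2 * R b)"
        using n(2)[OF that] M R by (intro mult_left_mono) auto
      also have "\<dots> = K * (c * (R b)\<^sup>2)" using c by (simp add: K_def power2_eq_square)
      also have "\<dots> \<le> K * (E b - E (Suc b))" by (rule mult_left_mono[OF decE K])
      finally show ?thesis using incr[of b n] by linarith
    qed
    \<comment> \<open>The step bounds telescope; this is applied on both sides of the pivot
      \<open>n\<close>.\<close>
    have range: "\<bar>(X p' - X p) \<bullet> (X n - z)\<bar> \<le> K * (E p - E p')"
      if "p \<le> p'" "k \<le> p" "p' \<le> l" for p p'
      using that
    proof (induction p' rule: dec_induct)
      case base
      then show ?case by simp
    next
      case (step b)
      have "(X (Suc b) - X p) \<bullet> (X n - z) = (X (Suc b) - X b) \<bullet> (X n - z) + (X b - X p) \<bullet> (X n - z)"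
        by (simp add: inner_diff_left)
      moreover have "\<bar>(X b - X p) \<bullet> (X n - z)\<bar> \<le> K * (E p - E b)" using step by simp
      moreover have "\<bar>(X (Suc b) - X b) \<bullet> (X n - z)\<bar> \<le> K * (E b - E (Suc b))"
        using step by (intro step_bound) auto
      moreover have "K * (E p - E (Suc b)) = K * (E p - E b) + K * (E b - E (Suc b))"
        by (simp add: algebra_simps)
      ultimately show ?case by linarith
    qed
    have kn: "(norm (X k - X n))\<^sup>2 \<le> (E k - E n) + 2 * (K * (E k - E n))"
      using polar[of k n] range[of k n] n(1) by auto
    have "(X n - X l) \<bullet> (X n - z) \<le> K * (E n - E l)"
      using range[of n l] n(1) by (auto simp: inner_diff_left)
    moreover have "E l \<le> E n" using anti n(1) by (auto simp: decseq_def)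
    \<comment> \<open>The identity \<open>polar\<close> produces the nonpositive term
      \<open>E l - E n\<close>; replacing it by its negative gives a bound that adds up with
      \<open>kn\<close> to a multiple of \<open>E k - E l\<close>.\<close>
    ultimately have nl: "(norm (X l - X n))\<^sup>2 \<le> (E n - E l) + 2 * (K * (E n - E l))"
      using polar[of l n] by linarith
    have "(norm (X k - X l))\<^sup>2 + (norm ((X k - X n) + (X l - X n)))\<^sup>2
        = 2 * (norm (X k - X n))\<^sup>2 + 2 * (norm (X l - X n))\<^sup>2"
      unfolding power2_norm_eq_inner
      by (simp add: inner_diff_left inner_diff_right inner_add_left inner_add_right inner_commute)
    then have "(norm (X k - X l))\<^sup>2 \<le> 2 * (norm (X k - X n))\<^sup>2 + 2 * (norm (X l - X n))\<^sup>2"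
      by (metis le_add_same_cancel1 zero_le_power2)
    also have "\<dots> \<le> 2 * ((E k - E n) + 2 * (K * (E k - E n))) + 2 * ((E n - E l) + 2 * (K * (E n - E l)))"
      by (intro add_mono mult_left_mono kn nl) auto
    also have "\<dots> = 2 * (1 + 2 * K) * (E k - E l)" by (simp add: algebra_simps)
    finally show ?thesis .
  qed
  define L where "L = 2 * (1 + 2 * K)"
  have L: "L > 0" using K by (simp add: L_def)
  have "convergent E"
    using decseq_convergent[OF anti, of 0] by (auto simp: E_def convergent_def)
  then have "Cauchy E" by (rule convergent_Cauchy)
  show ?thesis
  proof (rule metric_CauchyI)
    fix e :: real assume e: "e > 0"
    then have "e\<^sup>2 / L > 0" using L by simp
    then obtain m where m: "\<And>k l. k \<ge> m \<Longrightarrow> l \<ge> m \<Longrightarrow> dist (E k) (E l) < e\<^sup>2 / L"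
      using metric_CauchyD[OF \<open>Cauchy E\<close>] by meson
    have ordered: "dist (X k) (X l) < e" if "k \<ge> m" "k \<le> l" for k l
    proof -
      have "E k - E l < e\<^sup>2 / L" using m[of k l] that by (simp add: dist_real_def)
      then have "L * (E k - E l) < e\<^sup>2" using L by (simp add: field_simps)
      then have "(norm (X k - X l))\<^sup>2 < e\<^sup>2" using close[OF that(2)] by (simp add: L_def)
      then show ?thesis using e by (simp add: dist_norm power_less_imp_less_base)
    qed
    show "\<exists>m. \<forall>k\<ge>m. \<forall>l\<ge>m. dist (X k) (X l) < e"
      using ordered by (metis dist_commute nat_le_linear)
  qed
qed

section \<open>One step of the iteration\<close>

text \<open>\<open>\<alpha>_large\<close> is the lower bound on \<alpha> with the denominator
  \<open>1 - q\<close> cleared; \<open>\<eta>_less\<close> is what the condition involving \<tau>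
  yields.\<close>

locale levenberg_marquardt_kaczmarz =
  fixes N :: nat
    and F :: "nat \<Rightarrow> 'a::{real_inner, complete_space} \<Rightarrow> 'b::{real_inner, complete_space}"
    and F' :: "nat \<Rightarrow> 'a \<Rightarrow> ('a \<Rightarrow>\<^sub>L 'b)"
    and y :: "nat \<Rightarrow> 'b"
    and x0 xs :: 'a
    and \<rho> C \<eta> \<alpha> q :: real
  assumes N_pos: "0 < N"
    and C_pos: "0 < C" and deriv_bound: "\<And>i x. i < N \<Longrightarrow> x \<in> ball x0 \<rho> \<Longrightarrow> norm (F' i x) \<le> C"
    and tangential_cone: "\<And>i x x'. i < N \<Longrightarrow> x \<in> ball x0 \<rho> \<Longrightarrow> x' \<in> ball x0 \<rho> \<Longrightarrow>
           norm (F i x' - F i x - F' i x (x' - x)) \<le> \<eta> * norm (F i x' - F i x)"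
    and xs_near: "xs \<in> ball x0 (\<rho> / 2)" and xs_sol: "\<And>i. i < N \<Longrightarrow> F i xs = y i"
    and \<eta>_nonneg: "0 \<le> \<eta>" and \<eta>_less: "\<eta> < q" and q_less: "q < 1"
    and \<alpha>_pos: "0 < \<alpha>" and \<alpha>_large: "q * (\<alpha> + C\<^sup>2) \<le> \<alpha>"
begin

definition X :: "nat \<Rightarrow> 'a" where "X = lmk_iter N F F' y \<alpha> x0"
definition res :: "nat \<Rightarrow> 'b" where "res k = y (k mod N) - F (k mod N) (X k)"
definition A :: "nat \<Rightarrow> 'a \<Rightarrow>\<^sub>L 'b" where "A k = F' (k mod N) (X k)"
definition h :: "nat \<Rightarrow> 'a" where "h k = lm_step (A k) \<alpha> (res k)"
definition w :: "nat \<Rightarrow> 'b" where "w k = (1 / \<alpha>) *\<^sub>R (res k - A k (h k))"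

lemma xs_ball: "xs \<in> ball x0 \<rho>"
  using xs_near zero_le_dist[of x0 xs] unfolding mem_ball by linarith

lemma X_0: "X 0 = x0"
  by (simp add: X_def)

lemma X_Suc: "X (Suc k) = X k + h k"
  by (simp add: X_def h_def A_def res_def Let_def)

lemma mod_N: "k mod N < N"
  using N_pos by simp

text \<open>Weak form of \<open>h k\<close> being the adjoint of \<open>A k\<close> applied to
  \<open>w k\<close>: it moves every inner product with an increment into the data space, where the
  cone condition acts.\<close>

lemma h_inner: "h k \<bullet> v = w k \<bullet> A k v"
proof -
  have "\<alpha> * (h k \<bullet> v) = \<alpha> * (w k \<bullet> A k v)"
    using lm_step_inner[OF \<alpha>_pos, of "A k" "res k" v] \<alpha>_pos by (simp add: h_def w_def)
  then show ?thesis using \<alpha>_pos by simp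
qed

lemma res_eq: "res k = \<alpha> *\<^sub>R w k + A k (h k)"
  using \<alpha>_pos by (simp add: w_def)

text \<open>Pair \<open>res_eq\<close> with \<open>w k\<close>; by \<open>h_inner\<close> the mixed
  term is the squared norm of \<open>h k\<close>.\<close>

lemma inner_res_w: "res k \<bullet> w k = \<alpha> * (norm (w k))\<^sup>2 + (norm (h k))\<^sup>2"
proof -
  have "res k \<bullet> w k = \<alpha> * (w k \<bullet> w k) + w k \<bullet> A k (h k)"
    by (subst res_eq) (simp add: inner_add_left inner_commute[of "A k (h k)"])
  then show ?thesis by (simp only: h_inner[symmetric] power2_norm_eq_inner)
qed

lemma w_le: "\<alpha> * norm (w k) \<le> norm (res k)"
proof (cases "w k = 0")
  case False
  have "\<alpha> * norm (w k) * norm (w k) \<le> res k \<bullet> w k"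
    unfolding inner_res_w by (simp add: power2_eq_square)
  also have "\<dots> \<le> norm (res k) * norm (w k)" by (rule norm_cauchy_schwarz)
  finally show ?thesis using False by simp
qed simp

text \<open>Both \<open>x0\<close> and \<open>X k\<close> are closer than \<open>\<rho> / 2\<close>
  to \<open>xs\<close>. The conditional form lets the induction for \<open>X_error_le\<close> obtain
  ball membership from the error bound.\<close>

lemma ball_of_error_le:
  assumes "norm (X k - xs) \<le> norm (x0 - xs)"
  shows "X k \<in> ball x0 \<rho>"
proof -
  have "dist x0 (X k) \<le> dist x0 xs + dist xs (X k)" by (rule dist_triangle)
  then show ?thesis using assms xs_near by (simp add: dist_norm norm_minus_commute)
qed

lemma A_apply_le: "X k \<in> ball x0 \<rho> \<Longrightarrow> norm (A k v) \<le> C * norm v"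
  unfolding A_def using deriv_bound[OF mod_N] norm_blinfun
  by (meson mult_right_mono norm_ge_zero order_trans)

lemma h_le:
  assumes "X k \<in> ball x0 \<rho>"
  shows "norm (h k) \<le> C * norm (w k)"
proof (cases "h k = 0")
  case False
  have "norm (h k) * norm (h k) = w k \<bullet> A k (h k)"
    using h_inner[of k "h k"] by (simp add: power2_norm_eq_inner[symmetric] power2_eq_square)
  also have "\<dots> \<le> norm (w k) * norm (A k (h k))" by (rule norm_cauchy_schwarz)
  also have "\<dots> \<le> norm (w k) * (C * norm (h k))"
    by (intro mult_left_mono A_apply_le assms) auto
  finally have "norm (h k) * norm (h k) \<le> C * norm (w k) * norm (h k)" by (simp add: mult_ac)
  then show ?thesis using False by simp
qed (use C_pos in auto)

text \<open>By \<open>res_eq\<close> and two uses of the bound \<open>C\<close>, the residual is at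
  most \<open>(\<alpha> + C\<^sup>2) * norm (w k)\<close>. This is where the lower bound on \<alpha>
  enters.\<close>

lemma w_ge:
  assumes "X k \<in> ball x0 \<rho>"
  shows "q * norm (res k) \<le> \<alpha> * norm (w k)"
proof -
  have q: "q > 0" using \<eta>_nonneg \<eta>_less by simp
  have "norm (res k) \<le> norm (\<alpha> *\<^sub>R w k) + norm (A k (h k))"
    using norm_triangle_ineq[of "\<alpha> *\<^sub>R w k" "A k (h k)"] by (simp add: res_eq[symmetric])
  also have "norm (A k (h k)) \<le> C * norm (h k)" by (rule A_apply_le[OF assms])
  also have "C * norm (h k) \<le> C * (C * norm (w k))"
    using C_pos by (intro mult_left_mono h_le assms) auto
  finally have "norm (res k) \<le> (\<alpha> + C\<^sup>2) * norm (w k)"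
    using \<alpha>_pos by (simp add: algebra_simps power2_eq_square)
  then have "q * norm (res k) \<le> q * ((\<alpha> + C\<^sup>2) * norm (w k))"
    using q by (intro mult_left_mono) auto
  also have "\<dots> \<le> \<alpha> * norm (w k)"
    using mult_right_mono[OF \<alpha>_large, of "norm (w k)"] by (simp add: mult.assoc)
  finally show ?thesis .
qed

text \<open>Two uses of \<open>w_ge\<close>: one gives the factor \<open>q - \<eta>\<close> in front
  of \<open>norm (w k) * norm (res k)\<close>, the other the factor \<open>q / \<alpha>\<close> in
  replacing \<open>w k\<close> by \<open>res k\<close>.\<close>

definition c :: real where "c = 2 * q * (q - \<eta>) / \<alpha>"

lemma c_pos: "c > 0"
  using \<eta>_nonneg \<eta>_less \<alpha>_pos by (simp add: c_def)

lemma error_decrease: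
  assumes X: "X k \<in> ball x0 \<rho>"
  shows "c * (norm (res k))\<^sup>2 \<le> (norm (X k - xs))\<^sup>2 - (norm (X (Suc k) - xs))\<^sup>2"
proof -
  define e where "e = xs - X k"
  \<comment> \<open>For exact data \<open>res k\<close> is the difference of \<open>F\<close> at
    \<open>xs\<close> and at \<open>X k\<close>, so this is the cone condition.\<close>
  have "norm (res k - A k e) \<le> \<eta> * norm (res k)"
    using tangential_cone[OF mod_N X xs_ball, of k] xs_sol[OF mod_N] by (simp add: res_def A_def e_def)
  then have "(res k - A k e) \<bullet> w k \<le> \<eta> * norm (res k) * norm (w k)"
    using norm_cauchy_schwarz[of "res k - A k e" "w k"]
    by (meson mult_right_mono norm_ge_zero order_trans)
  moreover have "norm (w k) * (q * norm (res k)) \<le> norm (w k) * (\<alpha> * norm (w k))"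
    by (intro mult_left_mono w_ge X) auto
  \<comment> \<open>Write \<open>A k e\<close> as \<open>res k\<close> minus the linearization error
    and use \<open>inner_res_w\<close>. The error costs at most \<eta>, and the \<alpha>-term gains
    at least \<open>q\<close>, times \<open>2 * norm (w k) * norm (res k)\<close>.\<close>
  moreover have "(norm (X (Suc k) - xs))\<^sup>2 - (norm (X k - xs))\<^sup>2
      = 2 * ((res k - A k e) \<bullet> w k) - 2 * \<alpha> * (norm (w k))\<^sup>2 - (norm (h k))\<^sup>2"
  proof -
    have "(norm (X (Suc k) - xs))\<^sup>2 - (norm (X k - xs))\<^sup>2 = (norm (h k))\<^sup>2 - 2 * (h k \<bullet> e)"
      unfolding X_Suc e_def power2_norm_eq_inner
      by (simp add: inner_add_left inner_add_right inner_diff_left inner_diff_right inner_commute)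
    also have "h k \<bullet> e = res k \<bullet> w k - (res k - A k e) \<bullet> w k"
      unfolding h_inner inner_diff_left by (simp add: inner_commute)
    finally show ?thesis by (simp add: inner_res_w algebra_simps)
  qed
  moreover have "(norm (h k))\<^sup>2 \<ge> 0" by (rule zero_le_power2)
  moreover have "norm (w k) * (\<alpha> * norm (w k)) = \<alpha> * (norm (w k))\<^sup>2"
    by (simp add: power2_eq_square)
  moreover have "2 * (q - \<eta>) * (norm (w k) * norm (res k))
      = 2 * (norm (w k) * (q * norm (res k))) - 2 * (\<eta> * norm (res k) * norm (w k))"
    by (simp add: algebra_simps)
  ultimately have *: "2 * (q - \<eta>) * (norm (w k) * norm (res k))
      \<le> (norm (X k - xs))\<^sup>2 - (norm (X (Suc k) - xs))\<^sup>2"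
    by argo
  have "c * (norm (res k))\<^sup>2 = 2 * (q - \<eta>) * (q * norm (res k) / \<alpha> * norm (res k))"
    by (simp add: c_def power2_eq_square)
  also have "\<dots> \<le> 2 * (q - \<eta>) * (norm (w k) * norm (res k))"
    using \<eta>_less \<alpha>_pos w_ge[OF X] by (intro mult_left_mono mult_right_mono) (auto simp: field_simps)
  finally show ?thesis using * by linarith
qed

lemma X_error_le: "norm (X k - xs) \<le> norm (x0 - xs)"
proof (induction k)
  case 0
  then show ?case by (simp add: X_0)
next
  case (Suc k)
  have "0 \<le> c * (norm (res k))\<^sup>2" using c_pos by simp
  then have "(norm (X (Suc k) - xs))\<^sup>2 \<le> (norm (X k - xs))\<^sup>2"
    using error_decrease[OF ball_of_error_le[OF Suc]] by linarith
  then have "norm (X (Suc k) - xs) \<le> norm (X k - xs)" by (rule power2_le_imp_le) simp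
  then show ?case using Suc by linarith
qed

lemma X_ball: "X k \<in> ball x0 \<rho>"
  by (rule ball_of_error_le[OF X_error_le])

lemma h_le_res: "norm (h k) \<le> C / \<alpha> * norm (res k)"
proof -
  have "norm (w k) \<le> norm (res k) / \<alpha>" using w_le[of k] \<alpha>_pos by (simp add: field_simps)
  then have "C * norm (w k) \<le> C * (norm (res k) / \<alpha>)" using C_pos by (intro mult_left_mono) auto
  then show ?thesis using h_le[OF X_ball, of k] by simp
qed

lemma \<eta>_less_1: "\<eta> < 1"
  using \<eta>_less q_less by simp

section \<open>Consequences of the tangential cone condition\<close>

lemma deriv_diff_le:
  assumes "i < N" "x \<in> ball x0 \<rho>" "x' \<in> ball x0 \<rho>"
  shows "norm (F' i x (x' - x)) \<le> (1 + \<eta>) * norm (F i x' - F i x)"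
  using tangential_cone[OF assms] norm_triangle_ineq2[of "F' i x (x' - x)" "F i x' - F i x"]
  by (simp add: norm_minus_commute algebra_simps)

text \<open>The linearization error is at most \<eta> times the difference being estimated, so it is
  absorbed on the left.\<close>

lemma F_lipschitz:
  assumes "i < N" "x \<in> ball x0 \<rho>" "x' \<in> ball x0 \<rho>"
  shows "norm (F i x' - F i x) \<le> C / (1 - \<eta>) * norm (x' - x)"
proof -
  have "norm (F' i x (x' - x)) \<le> C * norm (x' - x)"
    using deriv_bound[OF assms(1,2)] norm_blinfun by (meson mult_right_mono norm_ge_zero order_trans)
  then have "(1 - \<eta>) * norm (F i x' - F i x) \<le> C * norm (x' - x)"
    using tangential_cone[OF assms] norm_triangle_ineq2[of "F i x' - F i x" "F' i x (x' - x)"]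
    by (simp add: algebra_simps)
  then show ?thesis using \<eta>_less_1 by (simp add: field_simps)
qed

section \<open>Cycles of \<open>N\<close> steps and convergence\<close>

text \<open>Step \<open>b * N + i\<close> treats equation \<open>i\<close>, so each residual of
  cycle \<open>b\<close> is taken at its own iterate, not at the start of the cycle.\<close>

definition R :: "nat \<Rightarrow> real" where "R b = (\<Sum>i<N. norm (res (b * N + i)))"

lemma R_nonneg: "R b \<ge> 0"
  by (simp add: R_def sum_nonneg)

lemma res_le_R: "i < N \<Longrightarrow> norm (res (b * N + i)) \<le> R b"
  unfolding R_def by (rule member_le_sum) auto

lemma X_block: "X (b * N + i) - X (b * N) = (\<Sum>j<i. h (b * N + j))"
  by (induction i) (simp_all add: X_Suc algebra_simps)

lemma X_block_le:
  assumes "i \<le> N"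
  shows "norm (X (b * N + i) - X (b * N)) \<le> C / \<alpha> * R b"
proof -
  have "norm (X (b * N + i) - X (b * N)) \<le> (\<Sum>j<i. C / \<alpha> * norm (res (b * N + j)))"
    unfolding X_block by (intro order_trans[OF norm_sum] sum_mono h_le_res)
  also have "\<dots> \<le> (\<Sum>j<N. C / \<alpha> * norm (res (b * N + j)))"
    using assms C_pos \<alpha>_pos by (intro sum_mono2) auto
  finally show ?thesis by (simp add: R_def sum_distrib_left)
qed

text \<open>Cost of moving a residual back to the start of its cycle: the Lipschitz constant
  \<open>C / (1 - \<eta>)\<close> times the drift \<open>C / \<alpha> * R n\<close> within the
  cycle.\<close>

definition K :: real where "K = 1 + C / (1 - \<eta>) * (C / \<alpha>)"

lemma block_residual_le:
  assumes "i < N"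
  shows "norm (y i - F i (X (n * N))) \<le> K * R n"
proof -
  let ?x = "X (n * N + i)"
  have "norm (F i ?x - F i (X (n * N))) \<le> C / (1 - \<eta>) * norm (?x - X (n * N))"
    by (rule F_lipschitz[OF assms X_ball X_ball])
  also have "\<dots> \<le> C / (1 - \<eta>) * (C / \<alpha> * R n)"
    using assms C_pos \<eta>_less_1 by (intro mult_left_mono X_block_le) auto
  finally have "norm (F i ?x - F i (X (n * N))) \<le> C / (1 - \<eta>) * (C / \<alpha>) * R n" by simp
  moreover have "norm (y i - F i ?x) \<le> R n"
    using res_le_R[OF assms, of n] assms by (simp add: res_def)
  moreover have "norm (y i - F i (X (n * N))) \<le> norm (y i - F i ?x) + norm (F i ?x - F i (X (n * N)))"
    using norm_triangle_ineq[of "y i - F i ?x" "F i ?x - F i (X (n * N))"] by simp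
  ultimately show ?thesis unfolding K_def distrib_right by linarith
qed

text \<open>By \<open>h_inner\<close> the product is
  \<open>w j \<bullet> A j (X (n * N) - xs)\<close>, and \<open>norm (w j)\<close> is at most
  \<open>norm (res j) / \<alpha>\<close>. Splitting the argument at \<open>X j\<close> makes
  \<open>deriv_diff_le\<close> applicable to both parts.\<close>

lemma step_inner_le:
  assumes "i < N"
  shows "\<bar>h (b * N + i) \<bullet> (X (n * N) - xs)\<bar>
    \<le> (1 + \<eta>) / \<alpha> * (2 + K) * norm (res (b * N + i)) * (R b + R n)"
proof -
  define j where "j = b * N + i"
  have j: "j mod N = i" using assms by (simp add: j_def)
  let ?u = "X (n * N)"
  have K: "K \<ge> 1" using C_pos \<alpha>_pos \<eta>_less_1 by (simp add: K_def)
  have "norm (A j (?u - X j)) \<le> (1 + \<eta>) * norm (F i ?u - F i (X j))"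
    using deriv_diff_le[OF mod_N X_ball X_ball, of j j "n * N"] by (simp add: A_def j)
  also have "\<dots> \<le> (1 + \<eta>) * (norm (res j) + norm (y i - F i ?u))"
    using \<eta>_nonneg norm_triangle_ineq4[of "res j" "y i - F i ?u"]
    by (intro mult_left_mono) (auto simp: res_def j)
  finally have 1: "norm (A j (?u - X j)) \<le> (1 + \<eta>) * (norm (res j) + norm (y i - F i ?u))" .
  have 2: "norm (A j (xs - X j)) \<le> (1 + \<eta>) * norm (res j)"
    using deriv_diff_le[OF mod_N X_ball xs_ball, of j j] assms by (simp add: A_def j res_def xs_sol)
  have "A j (?u - xs) = A j (?u - X j) - A j (xs - X j)"
    by (simp add: blinfun.diff_right[symmetric])
  then have "norm (A j (?u - xs)) \<le> norm (A j (?u - X j)) + norm (A j (xs - X j))"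
    by (simp add: norm_triangle_ineq4)
  also have "\<dots> \<le> (1 + \<eta>) * (2 * norm (res j) + norm (y i - F i ?u))"
    using 1 2 by (simp add: algebra_simps)
  also have "\<dots> \<le> (1 + \<eta>) * ((2 + K) * (R b + R n))"
  proof (intro mult_left_mono)
    have "norm (res j) \<le> R b" using res_le_R[OF assms] by (simp add: j_def)
    moreover have "norm (y i - F i ?u) \<le> K * R n" by (rule block_residual_le[OF assms])
    moreover have "0 \<le> K * R b" "0 \<le> R n" using K R_nonneg by auto
    ultimately show "2 * norm (res j) + norm (y i - F i ?u) \<le> (2 + K) * (R b + R n)"
      by (simp add: algebra_simps)
  qed (use \<eta>_nonneg in auto)
  finally have 3: "norm (A j (?u - xs)) \<le> (1 + \<eta>) * ((2 + K) * (R b + R n))" .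
  have "\<bar>h j \<bullet> (?u - xs)\<bar> \<le> norm (w j) * norm (A j (?u - xs))"
    unfolding h_inner by (rule Cauchy_Schwarz_ineq2)
  also have "\<dots> \<le> (norm (res j) / \<alpha>) * ((1 + \<eta>) * ((2 + K) * (R b + R n)))"
    using w_le[of j] \<alpha>_pos by (intro mult_mono 3) (auto simp: field_simps)
  finally show ?thesis by (simp add: j_def mult_ac)
qed

lemma block_inner_le:
  "\<bar>(X (Suc b * N) - X (b * N)) \<bullet> (X (n * N) - xs)\<bar> \<le> (1 + \<eta>) / \<alpha> * (2 + K) * R b * (R b + R n)"
proof -
  have "X (Suc b * N) - X (b * N) = (\<Sum>i<N. h (b * N + i))"
    using X_block[of b N] by (simp add: add.commute)
  then have "\<bar>(X (Suc b * N) - X (b * N)) \<bullet> (X (n * N) - xs)\<bar>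
      \<le> (\<Sum>i<N. \<bar>h (b * N + i) \<bullet> (X (n * N) - xs)\<bar>)"
    by (simp add: inner_sum_left)
  also have "\<dots> \<le> (\<Sum>i<N. (1 + \<eta>) / \<alpha> * (2 + K) * norm (res (b * N + i)) * (R b + R n))"
    by (intro sum_mono step_inner_le) auto
  also have "\<dots> = (1 + \<eta>) / \<alpha> * (2 + K) * R b * (R b + R n)"
    unfolding R_def[of b] sum_distrib_left sum_distrib_right ..
  finally show ?thesis .
qed

lemma block_decrease:
  "c / N * (R b)\<^sup>2 \<le> (norm (X (b * N) - xs))\<^sup>2 - (norm (X (Suc b * N) - xs))\<^sup>2"
proof -
  \<comment> \<open>Cauchy-Schwarz over the \<open>N\<close> residuals, the source of the factor
    \<open>1 / N\<close>.\<close>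
  have "(R b)\<^sup>2 \<le> (\<Sum>i<N. (norm (res (b * N + i)))\<^sup>2) * N"
    unfolding R_def using sum_squared_le_sum_of_squares[of _ "{..<N}"] by simp
  then have "c / N * (R b)\<^sup>2 \<le> c / N * ((\<Sum>i<N. (norm (res (b * N + i)))\<^sup>2) * N)"
    using c_pos by (intro mult_left_mono) auto
  also have "\<dots> = (\<Sum>i<N. c * (norm (res (b * N + i)))\<^sup>2)"
    using N_pos by (simp add: sum_distrib_left)
  also have "\<dots> \<le> (\<Sum>i<N. (norm (X (b * N + i) - xs))\<^sup>2 - (norm (X (b * N + Suc i) - xs))\<^sup>2)"
    by (intro sum_mono) (use error_decrease[OF X_ball] in simp)
  also have "\<dots> = (norm (X (b * N) - xs))\<^sup>2 - (norm (X (Suc b * N) - xs))\<^sup>2"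
    by (subst sum_lessThan_telescope') (simp add: add.commute)
  finally show ?thesis .
qed

text \<open>The squared errors at the cycle starts decrease and are nonnegative, so their drops tend
  to zero.\<close>

lemma R_tendsto_0: "R \<longlonglongrightarrow> 0"
proof -
  define E where "E b = (norm (X (b * N) - xs))\<^sup>2" for b
  have dec: "c / N * (R b)\<^sup>2 \<le> E b - E (Suc b)" for b
    using block_decrease by (simp add: E_def)
  have nn: "0 \<le> c / N * (R b)\<^sup>2" for b using c_pos by simp
  have "decseq E" using dec nn by (intro decseq_SucI) (smt (verit))
  then obtain L where "E \<longlonglongrightarrow> L" using decseq_convergent[of E 0] by (auto simp: E_def)
  then have "(\<lambda>b. E b - E (Suc b)) \<longlonglongrightarrow> L - L" by (intro tendsto_diff LIMSEQ_Suc)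
  then have lim0: "(\<lambda>b. E b - E (Suc b)) \<longlonglongrightarrow> 0" by simp
  have "norm (c / N * (R b)\<^sup>2) \<le> E b - E (Suc b)" for b
    unfolding real_norm_def abs_of_nonneg[OF nn] by (rule dec)
  from this lim0 have "(\<lambda>b. c / N * (R b)\<^sup>2) \<longlonglongrightarrow> 0"
    by (rule Lim_null_comparison[OF always_eventually[OF allI]])
  then have "(\<lambda>b. N / c * (c / N * (R b)\<^sup>2)) \<longlonglongrightarrow> N / c * 0" by (intro tendsto_mult_left)
  then have "(\<lambda>b. (R b)\<^sup>2) \<longlonglongrightarrow> 0" using c_pos N_pos by simp
  then have "(\<lambda>b. sqrt ((R b)\<^sup>2)) \<longlonglongrightarrow> sqrt 0" by (rule tendsto_real_sqrt)
  then show ?thesis using R_nonneg by simp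
qed

lemma convergent_X: "convergent X"
proof -
  have "Cauchy (\<lambda>b. X (b * N))"
  proof (rule Cauchy_of_energy_decrease)
    show "0 < c / N" using c_pos N_pos by simp
    show "0 \<le> (1 + \<eta>) / \<alpha> * (2 + K)"
      using C_pos \<alpha>_pos \<eta>_less_1 \<eta>_nonneg by (simp add: K_def)
  qed (rule R_nonneg block_decrease block_inner_le)+
  then obtain z where z: "(\<lambda>b. X (b * N)) \<longlonglongrightarrow> z"
    using Cauchy_convergent convergent_def by blast
  \<comment> \<open>From cycle starts to all indices: \<open>X k\<close> differs from the start of
    its cycle by at most \<open>C / \<alpha> * R (k div N)\<close>, which tends to zero.\<close>
  have div: "filterlim (\<lambda>k. k div N) at_top sequentially"
    using N_pos by (intro filterlim_at_top_div_const_nat) auto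
  have "(\<lambda>k. C / \<alpha> * R (k div N)) \<longlonglongrightarrow> C / \<alpha> * 0"
    by (intro tendsto_mult_left filterlim_compose[OF R_tendsto_0 div])
  then have lim0: "(\<lambda>k. C / \<alpha> * R (k div N)) \<longlonglongrightarrow> 0" by simp
  have "norm (X k - X (k div N * N)) \<le> C / \<alpha> * R (k div N)" for k
    using X_block_le[of "k mod N" "k div N"] mod_N[of k] by simp
  from this lim0 have "(\<lambda>k. X k - X (k div N * N)) \<longlonglongrightarrow> 0"
    by (rule Lim_null_comparison[OF always_eventually[OF allI]])
  then have "(\<lambda>k. (X k - X (k div N * N)) + X (k div N * N)) \<longlonglongrightarrow> 0 + z"
    by (intro tendsto_add filterlim_compose[OF z div])
  then show ?thesis by (auto simp: convergent_def)
qed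

section \<open>Identification of the limit\<close>

text \<open>The open ball is not closed under limits, but the non-strict error bound passes to
  \<open>z\<close> and again gives membership.\<close>

lemma limit_ball:
  assumes "X \<longlonglongrightarrow> z"
  shows "z \<in> ball x0 \<rho>"
proof -
  have "norm (z - xs) \<le> norm (x0 - xs)"
    by (rule Lim_bounded[of "\<lambda>k. norm (X k - xs)" _ 0])
      (use X_error_le in \<open>auto intro!: tendsto_intros assms\<close>)
  moreover have "dist x0 z \<le> dist x0 xs + dist xs z" by (rule dist_triangle)
  ultimately show ?thesis using xs_near by (simp add: dist_norm norm_minus_commute)
qed

lemma limit_solution:
  assumes z: "X \<longlonglongrightarrow> z" and "i < N"
  shows "F i z = y i"
proof -
  have "(\<lambda>b. X (b * N)) \<longlonglongrightarrow> z"
    by (rule filterlim_compose[OF z mult_nat_right_at_top[OF N_pos]])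
  then have "(\<lambda>b. K * R b + C / (1 - \<eta>) * norm (X (b * N) - z)) \<longlonglongrightarrow> K * 0 + C / (1 - \<eta>) * norm (z - z)"
    by (intro tendsto_intros R_tendsto_0)
  moreover have "norm (y i - F i z) \<le> K * R b + C / (1 - \<eta>) * norm (X (b * N) - z)" for b
    using block_residual_le[OF \<open>i < N\<close>, of b] F_lipschitz[OF \<open>i < N\<close> limit_ball[OF z] X_ball, of "b * N"]
      norm_triangle_ineq[of "y i - F i (X (b * N))" "F i (X (b * N)) - F i z"] by simp
  ultimately have "norm (y i - F i z) \<le> K * 0 + C / (1 - \<eta>) * norm (z - z)"
    by (intro LIMSEQ_le_const) auto
  then show ?thesis by simp
qed

text \<open>Each increment is orthogonal to \<open>v\<close> because \<open>h_inner\<close> turns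
  the product into one with \<open>A k v = 0\<close>.\<close>

lemma limit_orthogonal:
  assumes z: "X \<longlonglongrightarrow> z" and v: "\<And>i x. i < N \<Longrightarrow> x \<in> ball x0 \<rho> \<Longrightarrow> F' i x v = 0"
  shows "(z - x0) \<bullet> v = 0"
proof -
  have "(X k - x0) \<bullet> v = 0" for k
  proof (induction k)
    case 0
    then show ?case by (simp add: X_0)
  next
    case (Suc k)
    have "h k \<bullet> v = 0" using v[OF mod_N X_ball] by (simp add: h_inner A_def)
    then show ?case using Suc by (simp add: X_Suc inner_diff_left inner_add_left)
  qed
  moreover have "(\<lambda>k. (X k - x0) \<bullet> v) \<longlonglongrightarrow> (z - x0) \<bullet> v"
    by (intro tendsto_intros z)
  ultimately show ?thesis by (simp add: LIMSEQ_const_iff)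
qed

lemma limit_eq_min_norm_solution:
  assumes z: "X \<longlonglongrightarrow> z" and xd: "xd \<in> ball x0 (\<rho> / 2)" "\<And>i. i < N \<Longrightarrow> F i xd = y i"
    and least: "\<And>x. x \<in> ball x0 (\<rho> / 2) \<Longrightarrow> (\<And>i. i < N \<Longrightarrow> F i x = y i) \<Longrightarrow> norm (xd - x0) \<le> norm (x - x0)"
    and kernel: "\<And>i x v. (\<And>i. i < N \<Longrightarrow> F' i xd v = 0) \<Longrightarrow> x \<in> ball x0 \<rho> \<Longrightarrow> i < N \<Longrightarrow> F' i x v = 0"
  shows "z = xd"
proof -
  have xd_ball: "xd \<in> ball x0 \<rho>" using xd(1) zero_le_dist[of x0 xd] unfolding mem_ball by linarith
  \<comment> \<open>Both points solve the system, so the right-hand side of the cone condition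
    vanishes.\<close>
  have "F' i xd (z - xd) = 0" if "i < N" for i
    using tangential_cone[OF that xd_ball limit_ball[OF z]] limit_solution[OF z that] xd(2)[OF that]
    by simp
  then have "(z - x0) \<bullet> (z - xd) = 0"
    using kernel by (intro limit_orthogonal[OF z]) blast
  then have pyth: "(norm (xd - x0))\<^sup>2 = (norm (z - x0))\<^sup>2 + (norm (z - xd))\<^sup>2"
    unfolding power2_norm_eq_inner
    by (simp add: inner_diff_left inner_diff_right inner_commute)
  then have "(norm (z - x0))\<^sup>2 \<le> (norm (xd - x0))\<^sup>2" by simp
  then have "norm (z - x0) \<le> norm (xd - x0)" by (rule power2_le_imp_le) simp
  \<comment> \<open>Minimality compares only solutions in the half-radius ball, so \<open>z\<close>
    has to be placed there first.\<close>
  then have "z \<in> ball x0 (\<rho> / 2)" using xd(1) by (simp add: dist_norm norm_minus_commute)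
  then have "norm (xd - x0) \<le> norm (z - x0)" using least limit_solution[OF z] by blast
  then have "(norm (xd - x0))\<^sup>2 \<le> (norm (z - x0))\<^sup>2" by (rule power_mono) simp
  then have "(norm (z - xd))\<^sup>2 \<le> 0" using pyth by linarith
  then show ?thesis by simp
qed

end

section \<open>Componentwise form of the tuple conditions and the final statement\<close>

lemma prod_map_eq_restrict_iff: "prod_map N F x = restrict y {..<N} \<longleftrightarrow> (\<forall>i<N. F i x = y i)"
  by (auto simp: prod_map_def restrict_def fun_eq_iff)

lemma mem_prod_null_space_iff: "v \<in> prod_null_space N F' x \<longleftrightarrow> (\<forall>i<N. F' i x v = 0)"
  by (auto simp: prod_null_space_def prod_map_def restrict_def fun_eq_iff)

theorem theorem3p2:
  fixes N :: nat
    and D :: "nat \<Rightarrow> 'a::{real_inner, complete_space} set"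
    and F :: "nat \<Rightarrow> 'a \<Rightarrow> 'b::{real_inner, complete_space}"
    and F' :: "nat \<Rightarrow> 'a \<Rightarrow> ('a \<Rightarrow>\<^sub>L 'b)"
    and y :: "nat \<Rightarrow> 'b"
    and x0 xs :: 'a
    and \<rho> C \<eta> \<alpha> \<tau> q :: real
  assumes "N \<ge> 1"
    and "\<rho> > 0" and "ball x0 \<rho> \<subseteq> (\<Inter>i<N. D i)"
    and "\<And>i. i < N \<Longrightarrow> continuous_on (D i) (F i)"
    and "\<And>i. i < N \<Longrightarrow> continuous_on (D i) (F' i)"
    and "C > 0" and "\<And>i x. i < N \<Longrightarrow> x \<in> ball x0 \<rho> \<Longrightarrow> norm (F' i x) \<le> C"
    and "\<eta> < 1"
    and "\<And>i x x'. i < N \<Longrightarrow> x \<in> ball x0 \<rho> \<Longrightarrow> x' \<in> ball x0 \<rho> \<Longrightarrow>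
           norm (F i x' - F i x - F' i x (x' - x)) \<le> \<eta> * norm (F i x' - F i x)"
    and "xs \<in> ball x0 (\<rho> / 2)" and "prod_map N F xs = restrict y {..<N}"
    and "0 < q" and "q < 1" and "\<alpha> > C\<^sup>2 * q / (1 - q)"
    and "\<tau> > (1 + \<eta>) / (1 - \<eta>)" and "(1 + \<eta>) / (1 - \<eta>) > 1"
    and "\<eta> + (1 + \<eta>) * inverse \<tau> < q"
  shows "(\<forall>k. lmk_iter N F F' y \<alpha> x0 k \<in> D (k mod N)) \<and>
         (\<exists>z \<in> (\<Inter>i<N. D i). prod_map N F z = restrict y {..<N} \<and>
            lmk_iter N F F' y \<alpha> x0 \<longlonglongrightarrow> z) \<and>
         (\<forall>xd. min_norm_solution N F y x0 \<rho> xd \<and>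
            (\<forall>x \<in> ball x0 \<rho>. prod_null_space N F' xd \<subseteq> prod_null_space N F' x) \<longrightarrow>
            lmk_iter N F F' y \<alpha> x0 \<longlonglongrightarrow> xd)"
proof -
  have frac: "(1 + \<eta>) / (1 - \<eta>) > 1" and tau: "\<tau> > (1 + \<eta>) / (1 - \<eta>)" by fact+
  \<comment> \<open>A ratio above 1 with positive denominator \<open>1 - \<eta>\<close> forces
    \<eta> to be positive.\<close>
  then have \<eta>: "0 < \<eta>" using \<open>\<eta> < 1\<close> by (simp add: field_simps)
  have "\<tau> > 0" using frac tau by linarith
  then have "(1 + \<eta>) * inverse \<tau> > 0" using \<eta> by simp
  then have \<eta>q: "\<eta> < q" using \<open>\<eta> + (1 + \<eta>) * inverse \<tau> < q\<close> by linarith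
  have \<alpha>: "\<alpha> > C\<^sup>2 * q / (1 - q)" by fact
  moreover have "C\<^sup>2 * q / (1 - q) \<ge> 0" using \<open>0 < q\<close> \<open>q < 1\<close> by simp
  ultimately have \<alpha>_pos: "\<alpha> > 0" by linarith
  have \<alpha>_large: "q * (\<alpha> + C\<^sup>2) \<le> \<alpha>"
    using \<alpha> \<open>q < 1\<close> by (simp add: field_simps)
  interpret levenberg_marquardt_kaczmarz N F F' y x0 xs \<rho> C \<eta> \<alpha> q
  proof
    show "0 < N" using \<open>N \<ge> 1\<close> by simp
    show "F i xs = y i" if "i < N" for i
      using \<open>prod_map N F xs = restrict y {..<N}\<close> that by (simp add: prod_map_eq_restrict_iff)
    show "0 \<le> \<eta>" using \<eta> by simp
    show "norm (F' i x) \<le> C" if "i < N" "x \<in> ball x0 \<rho>" for i x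
      using that by (rule assms(7))
    show "norm (F i x' - F i x - F' i x (x' - x)) \<le> \<eta> * norm (F i x' - F i x)"
      if "i < N" "x \<in> ball x0 \<rho>" "x' \<in> ball x0 \<rho>" for i x x'
      using that by (rule assms(9))
  qed fact+
  note iter = X_def[symmetric]
  have ball_D: "x \<in> D i" if "x \<in> ball x0 \<rho>" "i < N" for x i
    using \<open>ball x0 \<rho> \<subseteq> (\<Inter>i<N. D i)\<close> that by blast
  obtain z where z: "X \<longlonglongrightarrow> z" using convergent_X by (auto simp: convergent_def)
  \<comment> \<open>The limit \<open>z\<close> is fixed before \<open>xd\<close>, so the second
    claim reduces to an equality of points.\<close>
  have "z = xd" if xd: "min_norm_solution N F y x0 \<rho> xd"
    and kernel: "\<forall>x \<in> ball x0 \<rho>. prod_null_space N F' xd \<subseteq> prod_null_space N F' x" for xd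
  proof (rule limit_eq_min_norm_solution[OF z])
    show "xd \<in> ball x0 (\<rho> / 2)" "\<And>i. i < N \<Longrightarrow> F i xd = y i"
      using xd by (auto simp: min_norm_solution_def prod_map_eq_restrict_iff)
    show "F' i x v = 0" if "\<And>i. i < N \<Longrightarrow> F' i xd v = 0" "x \<in> ball x0 \<rho>" "i < N" for i x v
      using kernel that by (meson mem_prod_null_space_iff subsetD)
    show "norm (xd - x0) \<le> norm (x - x0)"
      if "x \<in> ball x0 (\<rho> / 2)" "\<And>i. i < N \<Longrightarrow> F i x = y i" for x
    proof -
      have "Inf {norm (x - x0) | x. x \<in> ball x0 (\<rho> / 2) \<and> prod_map N F x = restrict y {..<N}} \<le> norm (x - x0)"
      proof (rule cInf_lower)
        show "norm (x - x0) \<in> {norm (x - x0) | x. x \<in> ball x0 (\<rho> / 2) \<and> prod_map N F x = restrict y {..<N}}"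
          using that by (auto simp: prod_map_eq_restrict_iff)
      qed (auto intro!: bdd_belowI[of _ 0])
      then show ?thesis using xd by (simp add: min_norm_solution_def)
    qed
  qed
  then show ?thesis
    unfolding iter using z X_ball ball_D limit_ball[OF z] limit_solution[OF z] mod_N
    by (auto simp: prod_map_eq_restrict_iff intro!: bexI[of _ z])
qed

end
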